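(* Let $m,n\ge 1$, $k=\min\{m,n\}$, and let $G\in\mathbb{R}^{m\times n}$. Let $H:[0,\infty)\to\mathbb{R}$ be strictly increasing and such that the function $x\mapsto H(\sqrt{x})$ is convex on $[0,\infty)$. Then there exist a global solution $Q^\star$ of the isotropic curvature model $$\min_{Q\in\mathbb{R}^{m\times n}}\; -\operatorname{Tr}(QG^\top)+\mathbb{E}_{\zeta}\,H(\|Q\zeta\|),$$ orthogonal matrices $U\in\mathbb{R}^{m\times m}$, $V\in\mathbb{R}^{n\times n}$, and $m\times n$ diagonal matrices $\Sigma=\mathrm{diag}(\sigma_1,\dots,\sigma_k)$ and $\Sigma^\star=\mathrm{diag}(\sigma_1^\star,\dots,\sigma_k^\star)$ with nonnegative diagonal entries, such that $G=U\Sigma V^\top$ and $Q^\star=U\Sigma^\star V^\top$, and the following two statements hold: (a) For any $1\le i,j\le k$, if $\sigma_i\ge\sigma_j$, then $\sigma_i^\star\ge\sigma_j^\star$. (b) For all $1\le i,j\le k$, $$\frac{\max\{\sigma_i^\star,\sigma_j^\star\}}{\min\{\sigma_i^\star,\sigma_j^\star\}}\le\frac{\max\{\sigma_i,\sigma_j\}}{\min\{\sigma_i,\sigma_j\}}.$$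
   Context: $\|\cdot\|$ is the Euclidean norm on $\mathbb{R}^m$, and $\zeta$ is a random vector uniformly distributed on the unit sphere of $\mathbb{R}^n$. The diagonal entries of $\Sigma$ and $\Sigma^\star$ are the singular values of $G$ and $Q^\star$; they are not assumed to be listed in any particular (e.g. decreasing) order. A global solution is a matrix attaining the minimum. Conventions for the ratios in (b): $0/0=1$, $s/0=\infty$ for $s>0$, and $\infty\le\infty$. *)

theory Defs
  imports "HOL-Probability.Probability"
begin

text \<open>
  The uniform probability measure on the unit sphere (normalised surface measure), as a Borel
  measure on the ambient space: radial projection of normalised Lebesgue measure on the unit ball.
  The value \<open>sgn 0 = 0\<close> is attained with probability zero. The lemmas below show that this is a
  probability measure concentrated on the sphere and invariant under orthogonal transformations.
\<close>

definition uniform_sphere :: "'a::euclidean_space measure" where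
  "uniform_sphere = distr (uniform_measure lborel (ball 0 1)) borel sgn"

lemma prob_space_uniform_sphere: "prob_space (uniform_sphere :: 'a::euclidean_space measure)"
proof -
  have "prob_space (uniform_measure lborel (ball (0::'a) 1))"
    by (intro prob_space_uniform_measure)
       (use emeasure_lborel_ball_finite[of "0::'a" 1] unit_ball_vol_pos[of "real DIM('a)"] in \<open>auto simp: emeasure_ball simp del: unit_ball_vol_pos\<close>)
  then show ?thesis
    unfolding uniform_sphere_def by (rule prob_space.prob_space_distr) simp
qed

lemma AE_uniform_sphere: "AE x in (uniform_sphere :: 'a::euclidean_space measure). norm x = 1"
proof -
  have "AE x in lborel. x \<noteq> (0::'a)"
    by (rule AE_lborel_singleton)
  then have "AE x in uniform_measure lborel (ball (0::'a) 1). norm (sgn x) = 1"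
    by (intro AE_uniform_measureI) (auto simp: norm_sgn)
  then show ?thesis
    unfolding uniform_sphere_def by (subst AE_distr_iff) simp_all
qed

lemma emeasure_lborel_orthogonal_le:
  fixes f :: "'a::euclidean_space \<Rightarrow> 'a"
  assumes f: "orthogonal_transformation f" and U: "open U"
  shows "emeasure lborel U \<le> emeasure lborel (f ` U)"
proof -
  define K where "K = {(a, e). 0 < e \<and> ball a e \<subseteq> U}"
  obtain C where C: "countable C" "C \<subseteq> K"
    and dj: "pairwise (\<lambda>i j. disjnt (ball (fst i) (snd i)) (ball (fst j) (snd j))) C"
    and neg: "negligible (U - (\<Union>i\<in>C. ball (fst i) (snd i)))"
  proof (rule Vitali_covering_theorem_balls[of U K fst snd])
    fix x and d :: real assume "x \<in> U" "0 < d"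
    obtain e where "0 < e" "ball x e \<subseteq> U"
      using U \<open>x \<in> U\<close> open_contains_ball by blast
    then have "(x, min e (d / 2)) \<in> K"
      using \<open>0 < d\<close> by (auto simp: K_def)
    then show "\<exists>i. i \<in> K \<and> x \<in> ball (fst i) (snd i) \<and> snd i < d"
      using \<open>0 < e\<close> \<open>0 < d\<close> by (intro exI[of _ "(x, min e (d / 2))"]) auto
  qed (use that in blast)
  let ?B = "\<lambda>i. ball (fst i) (snd i)"
  have sub: "(\<Union>i\<in>C. ?B i) \<subseteq> U"
    using C by (fastforce simp: K_def)
  have disj: "disjoint_family_on ?B C"
    using dj by (auto simp: disjoint_family_on_def pairwise_def disjnt_def)
  have fB: "f ` ?B i = ball (f (fst i)) (snd i)" for i
    by (rule image_orthogonal_transformation_ball[OF f])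
  have disj': "disjoint_family_on (\<lambda>i. f ` ?B i) C"
    using disj orthogonal_transformation_inj[OF f]
    by (auto simp: disjoint_family_on_def image_Int[symmetric])
  have [measurable]: "U \<in> sets borel" "(\<Union>i\<in>C. ?B i) \<in> sets borel"
    using U C by (auto intro!: sets.countable_UN'')
  have "emeasure lborel U \<le> emeasure lborel ((\<Union>i\<in>C. ?B i) \<union> (U - (\<Union>i\<in>C. ?B i)))"
    by (intro emeasure_mono) (auto simp del: UN_extend_simps Un_Diff_cancel, measurable)
  also have "\<dots> \<le> emeasure lborel (\<Union>i\<in>C. ?B i) + emeasure lborel (U - (\<Union>i\<in>C. ?B i))"
    by (intro emeasure_subadditive) measurable
  also have "emeasure lborel (U - (\<Union>i\<in>C. ?B i)) = 0"
    using neg by (simp add: negligible_iff_emeasure0 sets_completionI_sets)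
  also have "emeasure lborel (\<Union>i\<in>C. ?B i) = (\<integral>\<^sup>+i. emeasure lborel (?B i) \<partial>count_space C)"
    using disj C by (intro emeasure_UN_countable) auto
  also have "\<dots> = (\<integral>\<^sup>+i. emeasure lborel (f ` ?B i) \<partial>count_space C)"
    using C by (intro nn_integral_cong) (auto simp: fB emeasure_ball K_def)
  also have "\<dots> = emeasure lborel (\<Union>i\<in>C. f ` ?B i)"
    using disj' C by (intro emeasure_UN_countable[symmetric]) (auto simp: fB)
  also have "\<dots> \<le> emeasure lborel (f ` U)"
  proof (intro emeasure_mono)
    show "(\<Union>i\<in>C. f ` ?B i) \<subseteq> f ` U" using sub by blast
    show "f ` U \<in> sets lborel"
      using open_surjective_linear_image[OF U, of f] f
      by (simp add: orthogonal_transformation_linear orthogonal_transformation_surj borel_open)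
  qed
  finally show ?thesis by simp
qed

lemma distr_lborel_orthogonal:
  fixes f :: "'a::euclidean_space \<Rightarrow> 'a"
  assumes f: "orthogonal_transformation f"
  shows "distr lborel borel f = lborel"
proof (rule lborel_eqI[symmetric])
  have fm [measurable]: "f \<in> borel_measurable borel"
    using f by (simp add: borel_measurable_continuous_onI linear_continuous_on
                  linear_linear orthogonal_transformation_linear)
  have g: "orthogonal_transformation (inv f)"
    by (rule orthogonal_transformation_inv[OF f])
  have bij: "bij f"
    by (rule orthogonal_transformation_bij[OF f])
  fix l u :: 'a
  assume lu: "\<And>b. b \<in> Basis \<Longrightarrow> l \<bullet> b \<le> u \<bullet> b"
  have vim: "f -` box l u = inv f ` box l u"
    using bij by (simp add: bij_vimage_eq_inv_image)
  have "emeasure lborel (inv f ` box l u) \<le> emeasure lborel (f ` inv f ` box l u)"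
    by (intro emeasure_lborel_orthogonal_le f open_surjective_linear_image)
       (use g in \<open>auto simp: orthogonal_transformation_linear orthogonal_transformation_surj\<close>)
  also have "f ` inv f ` box l u = box l u"
    using bij by (simp add: image_f_inv_f bij_is_surj)
  finally have "emeasure lborel (inv f ` box l u) = emeasure lborel (box l u)"
    using emeasure_lborel_orthogonal_le[OF g open_box] by (intro antisym) auto
  then show "emeasure (distr lborel borel f) (box l u) = (\<Prod>b\<in>Basis. (u - l) \<bullet> b)"
    using lu by (simp add: emeasure_distr vim emeasure_lborel_box)
qed simp

lemma distr_uniform_sphere_orthogonal:
  fixes f :: "'a::euclidean_space \<Rightarrow> 'a"
  assumes f: "orthogonal_transformation f"
  shows "distr uniform_sphere borel f = uniform_sphere"
proof -
  let ?N = "uniform_measure lborel (ball (0::'a) 1)"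
  have fm [measurable]: "f \<in> borel_measurable borel"
    using f by (simp add: borel_measurable_continuous_onI linear_continuous_on
                  linear_linear orthogonal_transformation_linear)
  have vim: "f -` ball 0 1 = ball 0 1"
    using f by (auto simp: orthogonal_transformation_norm)
  have N: "distr ?N borel f = ?N"
  proof (rule measure_eqI)
    fix A :: "'a set" assume "A \<in> sets (distr ?N borel f)"
    then have A [measurable]: "A \<in> sets borel" by simp
    have "emeasure lborel (ball 0 1 \<inter> f -` A) = emeasure lborel (f -` (ball 0 1 \<inter> A))"
      by (simp add: vim)
    also have "\<dots> = emeasure (distr lborel borel f) (ball 0 1 \<inter> A)"
      by (simp add: emeasure_distr)
    finally have *: "emeasure lborel (ball 0 1 \<inter> f -` A) = emeasure lborel (ball 0 1 \<inter> A)"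
      by (simp add: distr_lborel_orthogonal[OF f])
    have "f -` A \<in> sets lborel"
      using measurable_sets[OF fm A] by simp
    then show "emeasure (distr ?N borel f) A = emeasure ?N A"
      using A by (simp add: emeasure_distr *)
  qed simp
  have sgn: "f \<circ> sgn = sgn \<circ> f"
    using f by (auto simp: sgn_div_norm orthogonal_transformation_norm
                  linear_scale orthogonal_transformation_linear)
  have "distr uniform_sphere borel f = distr ?N borel (f \<circ> sgn)"
    unfolding uniform_sphere_def by (simp add: distr_distr)
  also have "\<dots> = distr (distr ?N borel f) borel sgn"
    by (simp add: distr_distr sgn)
  finally show ?thesis
    by (simp add: N uniform_sphere_def)
qed

definition curvature_objective ::
  "'s measure \<Rightarrow> ('s \<Rightarrow> real ^ 'n) \<Rightarrow> real ^ 'n ^ 'm \<Rightarrow> (real \<Rightarrow> real) \<Rightarrow> real ^ 'n ^ 'm \<Rightarrow> real" where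
  "curvature_objective M \<zeta> G H Q =
     - trace (Q ** transpose G) + prob_space.expectation M (\<lambda>x. H (norm (Q *v \<zeta> x)))"

text \<open>
  The Bochner integral is zero by convention on non-integrable functions; under the monotonicity
  hypothesis on \<open>H\<close> and a uniform \<open>\<zeta>\<close> this never applies.
\<close>

lemma integrable_curvature_term:
  fixes \<zeta> :: "'s \<Rightarrow> real ^ 'n" and Q :: "real ^ 'n ^ 'm" and H :: "real \<Rightarrow> real"
  assumes M: "prob_space M" and \<zeta>: "\<zeta> \<in> borel_measurable M"
    and unif: "distr M borel \<zeta> = uniform_sphere"
    and H: "strict_mono_on {0..} H"
  shows "integrable M (\<lambda>x. H (norm (Q *v \<zeta> x)))"
proof -
  interpret prob_space M by (rule M)
  have mono: "H a \<le> H b" if "0 \<le> a" "a \<le> b" for a b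
    using that by (cases "a = b") (auto intro!: less_imp_le strict_mono_onD[OF H])
  have "mono (\<lambda>t. H (max 0 t))"
    by (intro monoI mono) auto
  then have Hm: "(\<lambda>t. H (max 0 t)) \<in> borel_measurable borel"
    by (rule borel_measurable_mono)
  have Qm: "(\<lambda>x. Q *v \<zeta> x) \<in> borel_measurable M"
    by (rule measurable_compose[OF \<zeta>])
       (intro borel_measurable_continuous_onI linear_continuous_on, simp add: linear_linear)
  have meas: "(\<lambda>x. H (norm (Q *v \<zeta> x))) \<in> borel_measurable M"
    using measurable_compose[OF measurable_compose[OF Qm borel_measurable_norm] Hm] by simp
  obtain B where B: "\<And>z. norm (Q *v z) \<le> norm z * B"
    using bounded_linear.bounded[of "(*v) Q"] by (auto simp: linear_linear)
  have "AE x in M. norm (\<zeta> x) = 1"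
    using AE_uniform_sphere[where 'a = "real ^ 'n"] unfolding unif[symmetric]
    by (subst (asm) AE_distr_iff[OF \<zeta>]) auto
  then have "AE x in M. norm (H (norm (Q *v \<zeta> x))) \<le> \<bar>H 0\<bar> + \<bar>H B\<bar>"
  proof eventually_elim
    case (elim x)
    then have "norm (Q *v \<zeta> x) \<le> B"
      using B[of "\<zeta> x"] by simp
    then have "H 0 \<le> H (norm (Q *v \<zeta> x))" "H (norm (Q *v \<zeta> x)) \<le> H B"
      by (auto intro: mono)
    then show ?case by auto
  qed
  then show ?thesis
    by (rule integrable_const_bound[OF _ meas])
qed

text \<open>
  The finite index types carry no order, so the numberings \<open>r\<close> and \<open>c\<close> of the rows and columns,
  by \<open>1, \<dots>, m\<close> and \<open>1, \<dots>, n\<close>, are explicit. Only the values of \<open>\<sigma>\<close> on \<open>1, \<dots>, min m n\<close> matter.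
\<close>

definition rect_diag :: "('m \<Rightarrow> nat) \<Rightarrow> ('n \<Rightarrow> nat) \<Rightarrow> (nat \<Rightarrow> real) \<Rightarrow> real ^ 'n ^ 'm" where
  "rect_diag r c \<sigma> = (\<chi> i j. if r i = c j then \<sigma> (r i) else 0)"

text \<open>
  Ratio of nonnegative reals with \<open>0/0 = 1\<close> and \<open>s/0 = \<infinity>\<close> for \<open>s > 0\<close>;
  the library division on \<^typ>\<open>ereal\<close> has \<open>0/0 = 0\<close>.
\<close>

definition ext_ratio :: "real \<Rightarrow> real \<Rightarrow> ereal" where
  "ext_ratio s t = (if t = 0 then (if s = 0 then 1 else \<infinity>) else ereal (s / t))"

end

theory Submission
  imports Defs
begin

text \<open>
  The objective is \<open>E(Q) - Q \<bullet> G\<close>, where \<open>E(Q)\<close> is the expectation of \<open>H (norm (Q *v \<zeta>))\<close> and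
  \<open>trace (Q ** transpose G)\<close> is the Frobenius inner product. The proof rests on the fact that this
  function has exactly one minimiser; every property of the minimiser is then obtained by writing
  down a competitor that is at least as good, which must coincide with it.

  Write \<open>h x = H (sqrt x)\<close>, so that \<open>H (norm y) = h ((norm y)\<^sup>2)\<close>. By the parallelogram identity the
  squared norm of a midpoint is smaller than the mean of the squared norms by a multiple of the
  squared distance; as \<open>h\<close> is convex and strictly increasing, \<open>E\<close> is convex and strictly
  midpoint-convex (\<open>convex_energy\<close>, \<open>energy_midpoint_less\<close>). The coordinates of a uniform point of the
  sphere are uncorrelated with equal variances (\<open>sphere_second_moment\<close>), so \<open>norm (Q *v \<zeta>)\<close> has mean
  square \<open>(norm Q)\<^sup>2 / n\<close>; since \<open>h\<close> lies above an increasing affine function, \<open>E\<close> grows at least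
  quadratically (\<open>energy_coercive\<close>). Hence a minimiser exists (\<open>minimizer_exists\<close>) and is unique
  (\<open>minimizer_unique\<close>).

  Orthogonal factors on either side do not change \<open>E\<close>, so a singular value decomposition of \<open>G\<close>
  (\<open>singular_value_decomposition\<close>) reduces the problem to a diagonal \<open>G\<close> with entries \<open>\<sigma> i \<ge> 0\<close>.
  Flipping the sign of the \<open>p\<close>-th row and the \<open>p\<close>-th column leaves the objective unchanged, hence
  fixes the minimiser, hence kills its off-diagonal entries; replacing the diagonal entries by their
  absolute values cannot hurt (\<open>diagonal_minimizer_exists\<close>). Let \<open>s\<close> be the resulting diagonal.

  For (a), if \<open>\<sigma> j \<le> \<sigma> i\<close> but \<open>s i < s j\<close>, then swapping \<open>s i\<close> and \<open>s j\<close> is at least as good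
  (\<open>minimizer_order\<close>). Ties are covered, because uniqueness excludes even an equally good competitor.

  For (b), suppose \<open>0 < \<sigma> j \<le> \<sigma> i\<close> and \<open>s i / s j > \<sigma> i / \<sigma> j\<close>. Rotate \<open>(s i, s j)\<close> to the direction of
  \<open>(\<sigma> i, \<sigma> j)\<close>, keeping its length. The linear term improves by the Cauchy-Schwarz inequality. The
  squares of the new pair are a convex combination of \<open>((s i)\<^sup>2, (s j)\<^sup>2)\<close> and its swap
  (\<open>rotated_pair\<close>), and \<open>E\<close> is a symmetric convex function of the squared entries, so \<open>E\<close> does not
  increase (\<open>energy_D_mix\<close>). Uniqueness gives the contradiction (\<open>minimizer_cross\<close>).
\<close>

section \<open>Moments of the uniform distribution on the sphere\<close>

lemma sets_uniform_sphere [measurable_cong, simp]: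
  "sets (uniform_sphere :: 'a::euclidean_space measure) = sets borel"
  by (simp add: uniform_sphere_def)

lemma integral_uniform_sphere_orthogonal:
  fixes f :: "'a::euclidean_space \<Rightarrow> 'a" and g :: "'a \<Rightarrow> real"
  assumes f: "orthogonal_transformation f" and g: "g \<in> borel_measurable borel"
  shows "(LINT z|uniform_sphere. g (f z)) = (LINT z|uniform_sphere. g z)"
proof -
  have "f \<in> borel_measurable borel"
    using f by (simp add: borel_measurable_continuous_onI linear_continuous_on
                  linear_linear orthogonal_transformation_linear)
  then have "f \<in> uniform_sphere \<rightarrow>\<^sub>M borel"
    by (simp cong: measurable_cong_sets)
  then have "integral\<^sup>L (distr uniform_sphere borel f) g = (LINT z|uniform_sphere. g (f z))"
    by (rule integral_distr[OF _ g])
  then show ?thesis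
    by (simp add: distr_uniform_sphere_orthogonal[OF f])
qed

lemma orthogonal_transformation_permute:
  fixes \<pi> :: "'n::finite \<Rightarrow> 'n"
  assumes \<pi>: "bij \<pi>"
  shows "orthogonal_transformation (\<lambda>z :: real ^ 'n. \<chi> j. z $ \<pi> j)"
  unfolding orthogonal_transformation_def
proof (intro conjI allI)
  show "linear (\<lambda>z :: real ^ 'n. \<chi> j. z $ \<pi> j)"
    by (rule linearI) (auto simp: vec_eq_iff)
  show "(\<chi> j. v $ \<pi> j) \<bullet> (\<chi> j. w $ \<pi> j) = v \<bullet> w" for v w :: "real ^ 'n"
    using sum.reindex_bij_betw[OF \<pi>, of "\<lambda>j. v $ j * w $ j"] by (simp add: inner_vec_def)
qed

lemma orthogonal_transformation_signs:
  fixes \<epsilon> :: "'n::finite \<Rightarrow> real"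
  assumes \<epsilon>: "\<And>j. \<epsilon> j * \<epsilon> j = 1"
  shows "orthogonal_transformation (\<lambda>z :: real ^ 'n. \<chi> j. \<epsilon> j * z $ j)"
  unfolding orthogonal_transformation_def
proof (intro conjI allI)
  show "linear (\<lambda>z :: real ^ 'n. \<chi> j. \<epsilon> j * z $ j)"
    by (rule linearI) (auto simp: vec_eq_iff algebra_simps)
  have "\<epsilon> j * x * (\<epsilon> j * y) = x * y" for j x y
  proof -
    have "\<epsilon> j * x * (\<epsilon> j * y) = (\<epsilon> j * \<epsilon> j) * (x * y)"
      by (simp only: mult_ac)
    with \<epsilon> show ?thesis by simp
  qed
  then show "(\<chi> j. \<epsilon> j * v $ j) \<bullet> (\<chi> j. \<epsilon> j * w $ j) = v \<bullet> w" for v w :: "real ^ 'n"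
    by (simp only: inner_vec_def vec_lambda_beta inner_real_def)
qed

lemma integrable_sphere_moment:
  "integrable uniform_sphere (\<lambda>z :: real ^ 'n. z $ i * z $ j)"
proof -
  interpret prob_space "uniform_sphere :: (real ^ 'n) measure"
    by (rule prob_space_uniform_sphere)
  have "AE z :: real ^ 'n in uniform_sphere. norm (z $ i * z $ j) \<le> 1"
    using AE_uniform_sphere
  proof eventually_elim
    case (elim z)
    then have "\<bar>z $ i\<bar> \<le> 1" "\<bar>z $ j\<bar> \<le> 1"
      using component_le_norm_cart[of z] by auto
    then show ?case
      by (simp add: abs_mult mult_le_one)
  qed
  then show ?thesis
    by (rule integrable_const_bound) simp
qed

text \<open>
  Symmetry alone determines the second moments: flipping the sign of one coordinate shows that mixed
  moments vanish, exchanging two coordinates shows that all variances agree, and the variances add up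
  to \<open>1\<close> because the points have unit length.
\<close>

lemma sphere_second_moment:
  "(LINT z|uniform_sphere. (z :: real ^ 'n) $ i * z $ j) = (if i = j then 1 / real CARD('n) else 0)"
proof -
  interpret prob_space "uniform_sphere :: (real ^ 'n) measure"
    by (rule prob_space_uniform_sphere)
  let ?m = "\<lambda>i j. LINT z|uniform_sphere. (z :: real ^ 'n) $ i * z $ j"
  have off: "?m i j = 0" if "i \<noteq> j"
  proof -
    let ?\<epsilon> = "\<lambda>l. if l = i then - 1 else 1 :: real"
    have "?m i j = (LINT z|uniform_sphere. (\<chi> l. ?\<epsilon> l * (z :: real ^ 'n) $ l) $ i * (\<chi> l. ?\<epsilon> l * z $ l) $ j)"
      by (rule integral_uniform_sphere_orthogonal[symmetric, OF orthogonal_transformation_signs]) auto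
    then show ?thesis
      using that by simp
  qed
  have diag: "?m l l = ?m i i" for l
  proof -
    let ?\<pi> = "Transposition.transpose i l"
    have "?m l l = (LINT z|uniform_sphere. (\<chi> j. (z :: real ^ 'n) $ ?\<pi> j) $ l * (\<chi> j. z $ ?\<pi> j) $ l)"
      by (rule integral_uniform_sphere_orthogonal[symmetric, OF orthogonal_transformation_permute]) auto
    then show ?thesis
      by simp
  qed
  have "real CARD('n) * ?m i i = (\<Sum>l\<in>(UNIV :: 'n set). ?m i i)"
    by simp
  also have "\<dots> = (\<Sum>l\<in>UNIV. ?m l l)"
    by (rule sum.cong[OF refl diag[symmetric]])
  also have "\<dots> = (LINT z|uniform_sphere. (\<Sum>l\<in>UNIV. (z :: real ^ 'n) $ l * z $ l))"
    by (rule Bochner_Integration.integral_sum[symmetric]) (rule integrable_sphere_moment)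
  also have "\<dots> = (LINT z|(uniform_sphere :: (real ^ 'n) measure). 1)"
  proof (rule integral_cong_AE)
    show "AE z :: real ^ 'n in uniform_sphere. (\<Sum>l\<in>UNIV. z $ l * z $ l) = 1"
      using AE_uniform_sphere by eventually_elim (simp add: norm_eq_1 inner_vec_def)
  qed auto
  also have "\<dots> = 1"
    using prob_space by simp
  finally have "?m i i = 1 / real CARD('n)"
    by (simp add: field_simps)
  then show ?thesis
    using off by auto
qed

text \<open>
  The mean square detects \<open>Q = 0\<close>, which gives strict convexity of the expected curvature, and it
  grows quadratically in \<open>Q\<close>, which gives coercivity.
\<close>

lemma integrable_sphere_norm_sq:
  fixes Q :: "real ^ 'n ^ 'm"
  shows "integrable uniform_sphere (\<lambda>z. (norm (Q *v z))\<^sup>2)"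
    and "(LINT z|uniform_sphere. (norm (Q *v z))\<^sup>2) = (norm Q)\<^sup>2 / real CARD('n)"
proof -
  have eq: "(norm (Q *v z))\<^sup>2 = (\<Sum>i\<in>UNIV. \<Sum>j\<in>UNIV. \<Sum>l\<in>UNIV. (Q $ i $ j * Q $ i $ l) * (z $ j * z $ l))" for z
  proof -
    have "(norm (Q *v z))\<^sup>2 = (\<Sum>i\<in>UNIV. (\<Sum>j\<in>UNIV. Q $ i $ j * z $ j) * (\<Sum>j\<in>UNIV. Q $ i $ j * z $ j))"
      by (simp add: power2_norm_eq_inner inner_vec_def matrix_vector_mult_def)
    also have "\<dots> = (\<Sum>i\<in>UNIV. \<Sum>j\<in>UNIV. \<Sum>l\<in>UNIV. (Q $ i $ j * z $ j) * (Q $ i $ l * z $ l))"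
      by (simp only: sum_product)
    finally show ?thesis
      by (simp only: mult.assoc mult.left_commute)
  qed
  have int: "integrable uniform_sphere (\<lambda>z :: real ^ 'n. a * (z $ j * z $ l))" for a j l
    using integrable_sphere_moment by (intro integrable_mult_right) auto
  show "integrable uniform_sphere (\<lambda>z. (norm (Q *v z))\<^sup>2)"
    unfolding eq using int by (intro Bochner_Integration.integrable_sum)
  have "(LINT z|uniform_sphere. (norm (Q *v z))\<^sup>2) =
      (\<Sum>i\<in>UNIV. \<Sum>j\<in>UNIV. \<Sum>l\<in>UNIV. (Q $ i $ j * Q $ i $ l) * (LINT z|uniform_sphere. (z :: real ^ 'n) $ j * z $ l))"
    unfolding eq using int by (simp add: Bochner_Integration.integral_sum Bochner_Integration.integrable_sum)
  also have "\<dots> = (\<Sum>i\<in>UNIV. \<Sum>j\<in>UNIV. Q $ i $ j * Q $ i $ j / real CARD('n))"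
    by (simp add: sphere_second_moment if_distrib cong: if_cong)
  also have "\<dots> = (norm Q)\<^sup>2 / real CARD('n)"
    by (simp add: power2_norm_eq_inner inner_vec_def sum_divide_distrib)
  finally show "(LINT z|uniform_sphere. (norm (Q *v z))\<^sup>2) = (norm Q)\<^sup>2 / real CARD('n)" .
qed

section \<open>The expected curvature and its unique minimiser\<close>

locale isotropic_curvature =
  fixes H :: "real \<Rightarrow> real"
  assumes H_mono: "strict_mono_on {0..} H"
    and H_convex: "convex_on {0..} (\<lambda>x. H (sqrt x))"
begin

definition energy :: "real ^ 'n ^ 'm \<Rightarrow> real" where
  "energy Q = (LINT z|uniform_sphere. H (norm (Q *v z)))"

lemma H_le: "H a \<le> H b" if "0 \<le> a" "a \<le> b"
  using that by (cases "a = b") (auto intro!: less_imp_le strict_mono_onD[OF H_mono])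

lemma H_less: "H a < H b" if "0 \<le> a" "a < b"
  using that by (auto intro!: strict_mono_onD[OF H_mono])

lemma measurable_H_norm [measurable]: "(\<lambda>x. H (norm (x :: 'a::euclidean_space))) \<in> borel_measurable borel"
proof -
  have "mono (\<lambda>t. H (max 0 t))"
    by (intro monoI H_le) auto
  then have "(\<lambda>t. H (max 0 t)) \<in> borel_measurable borel"
    by (rule borel_measurable_mono)
  then have "(\<lambda>x :: 'a. H (max 0 (norm x))) \<in> borel_measurable borel"
    by (rule measurable_compose[rotated]) simp
  then show ?thesis
    by simp
qed

lemma measurable_H_matrix [measurable]:
  "(\<lambda>z. H (norm ((Q :: real ^ 'n ^ 'm) *v z))) \<in> borel_measurable borel"
proof -
  have "(\<lambda>z. Q *v z) \<in> borel_measurable borel"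
    by (intro borel_measurable_continuous_onI linear_continuous_on) (simp add: linear_linear)
  from measurable_compose[OF this measurable_H_norm] show ?thesis .
qed

lemma integrable_H: "integrable uniform_sphere (\<lambda>z. H (norm ((Q :: real ^ 'n ^ 'm) *v z)))"
  by (rule integrable_curvature_term[OF prob_space_uniform_sphere _ _ H_mono])
     (auto simp: distr_id2)

lemma curvature_objective_eq:
  fixes \<zeta> :: "'s \<Rightarrow> real ^ 'n" and G Q :: "real ^ 'n ^ 'm"
  assumes \<zeta>: "\<zeta> \<in> borel_measurable M" and unif: "distr M borel \<zeta> = uniform_sphere"
  shows "curvature_objective M \<zeta> G H Q = energy Q - Q \<bullet> G"
proof -
  have "trace (Q ** transpose G) = Q \<bullet> G"
    by (simp add: trace_def matrix_matrix_mult_def transpose_def inner_vec_def)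
  moreover have "energy Q = (LINT x|M. H (norm (Q *v \<zeta> x)))"
    unfolding energy_def unif[symmetric] by (rule integral_distr[OF \<zeta>]) measurable
  ultimately show ?thesis
    by (simp add: curvature_objective_def)
qed

text \<open>
  Convexity of \<open>x \<mapsto> H (sqrt x)\<close> treats equality of the squares, monotonicity of \<open>H\<close> the inequality.
\<close>

lemma H_convex_comb:
  assumes "0 \<le> a" "0 \<le> b" "0 \<le> c" "0 \<le> t" "t \<le> 1" "c\<^sup>2 \<le> (1 - t) * a\<^sup>2 + t * b\<^sup>2"
  shows "H c \<le> (1 - t) * H a + t * H b"
proof -
  have "H c \<le> H (sqrt ((1 - t) * a\<^sup>2 + t * b\<^sup>2))"
    using assms by (intro H_le) (auto intro: real_le_rsqrt)
  also have "\<dots> \<le> (1 - t) * H (sqrt (a\<^sup>2)) + t * H (sqrt (b\<^sup>2))"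
    using convex_onD[OF H_convex, of t "a\<^sup>2" "b\<^sup>2"] assms by simp
  finally show ?thesis
    using assms by simp
qed

text \<open>
  The last term is the defect that makes the convexity of the energy strict.
\<close>

lemma norm_convex_comb_sq:
  fixes x y :: "'a::real_inner"
  shows "(norm ((1 - t) *\<^sub>R x + t *\<^sub>R y))\<^sup>2 =
    (1 - t) * (norm x)\<^sup>2 + t * (norm y)\<^sup>2 - t * (1 - t) * (norm (x - y))\<^sup>2"
proof -
  have commute: "y \<bullet> x = x \<bullet> y"
    by (rule inner_commute)
  show ?thesis
    unfolding power2_norm_eq_inner inner_add_left inner_add_right inner_diff_left
      inner_diff_right inner_scaleR_left inner_scaleR_right commute
    by algebra
qed

lemma convex_energy: "convex_on UNIV (energy :: real ^ 'n ^ 'm \<Rightarrow> real)"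
proof (rule convex_onI)
  fix t :: real and P Q :: "real ^ 'n ^ 'm"
  assume t: "0 < t" "t < 1"
  have "energy ((1 - t) *\<^sub>R P + t *\<^sub>R Q) \<le>
      (LINT z|uniform_sphere. (1 - t) * H (norm (P *v z)) + t * H (norm (Q *v z)))"
    unfolding energy_def
  proof (rule integral_mono)
    fix z :: "real ^ 'n"
    show "H (norm (((1 - t) *\<^sub>R P + t *\<^sub>R Q) *v z)) \<le> (1 - t) * H (norm (P *v z)) + t * H (norm (Q *v z))"
      using t norm_convex_comb_sq[of t "P *v z" "Q *v z"]
      by (intro H_convex_comb)
         (auto simp: matrix_vector_mult_add_rdistrib scaleR_matrix_vector_assoc[symmetric])
  qed (auto intro!: integrable_H)
  also have "\<dots> = (1 - t) * energy P + t * energy Q"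
    unfolding energy_def by (simp add: integrable_H)
  finally show "energy ((1 - t) *\<^sub>R P + t *\<^sub>R Q) \<le> (1 - t) * energy P + t * energy Q" .
qed auto

text \<open>
  Strictness is pointwise wherever \<open>P\<close> and \<open>Q\<close> act differently on \<open>z\<close>. That set has positive measure,
  for otherwise the mean square of \<open>(P - Q) *v z\<close> would vanish.
\<close>

lemma energy_midpoint_less:
  fixes P Q :: "real ^ 'n ^ 'm"
  assumes "P \<noteq> Q"
  shows "energy ((1/2) *\<^sub>R P + (1/2) *\<^sub>R Q) < (energy P + energy Q) / 2"
proof -
  interpret prob_space "uniform_sphere :: (real ^ 'n) measure"
    by (rule prob_space_uniform_sphere)
  let ?A = "{z. (P - Q) *v z \<noteq> 0}"
  have A: "?A \<in> sets borel"
  proof -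
    have "continuous_on UNIV (\<lambda>z. (P - Q) *v z)"
      by (intro linear_continuous_on) (simp add: linear_linear)
    then have "open ?A"
      by (intro open_Collect_neq) auto
    then show ?thesis by simp
  qed
  have pos: "emeasure uniform_sphere ?A \<noteq> 0"
  proof
    assume "emeasure uniform_sphere ?A = 0"
    then have "AE z in uniform_sphere. (P - Q) *v z = 0"
      using A by (auto intro!: AE_I[of _ _ ?A])
    then have "(LINT z|uniform_sphere. (norm ((P - Q) *v z))\<^sup>2) = 0"
      by (intro integral_eq_zero_AE) auto
    then show False
      using assms by (simp add: integrable_sphere_norm_sq(2))
  qed
  have less: "H (norm (((1/2) *\<^sub>R P + (1/2) *\<^sub>R Q) *v z)) < (H (norm (P *v z)) + H (norm (Q *v z))) / 2"
    if "P *v z \<noteq> Q *v z" for z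
  proof -
    let ?x = "P *v z" and ?y = "Q *v z"
    let ?q = "sqrt (((norm ?x)\<^sup>2 + (norm ?y)\<^sup>2) / 2)"
    have "(norm ((1/2) *\<^sub>R ?x + (1/2) *\<^sub>R ?y))\<^sup>2 < ((norm ?x)\<^sup>2 + (norm ?y)\<^sup>2) / 2"
      using norm_convex_comb_sq[of "1/2" ?x ?y] that by simp
    then have "H (norm ((1/2) *\<^sub>R ?x + (1/2) *\<^sub>R ?y)) < H ?q"
      by (intro H_less real_less_rsqrt) auto
    also have "\<dots> \<le> (1 - 1/2) * H (norm ?x) + 1/2 * H (norm ?y)"
      by (rule H_convex_comb) auto
    finally show ?thesis
      by (simp add: matrix_vector_mult_add_rdistrib scaleR_matrix_vector_assoc[symmetric])
  qed
  have "energy ((1/2) *\<^sub>R P + (1/2) *\<^sub>R Q) < (LINT z|uniform_sphere. (H (norm (P *v z)) + H (norm (Q *v z))) / 2)"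
    unfolding energy_def
  proof (rule integral_less_AE[OF _ _ pos])
    show "AE z in uniform_sphere. z \<in> ?A \<longrightarrow> H (norm (((1/2) *\<^sub>R P + (1/2) *\<^sub>R Q) *v z)) \<noteq> (H (norm (P *v z)) + H (norm (Q *v z))) / 2"
      using less by (intro AE_I2) (force simp: matrix_vector_mult_diff_rdistrib)
    have "H (norm (((1/2) *\<^sub>R P + (1/2) *\<^sub>R Q) *v z)) \<le> (H (norm (P *v z)) + H (norm (Q *v z))) / 2" for z
    proof (cases "P *v z = Q *v z")
      case True
      have "(1/2 :: real) *\<^sub>R x + (1/2) *\<^sub>R x = x" for x :: "real ^ 'm"
        by (simp add: vec_eq_iff)
      then show ?thesis
        using True by (simp only: matrix_vector_mult_add_rdistrib scaleR_matrix_vector_assoc[symmetric]) simp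
    qed (use less in \<open>simp add: less_imp_le\<close>)
    then show "AE z in uniform_sphere. H (norm (((1/2) *\<^sub>R P + (1/2) *\<^sub>R Q) *v z)) \<le> (H (norm (P *v z)) + H (norm (Q *v z))) / 2"
      by simp
  qed (auto intro!: integrable_H A)
  also have "\<dots> = (energy P + energy Q) / 2"
    unfolding energy_def by (simp add: integrable_H)
  finally show ?thesis .
qed

text \<open>
  With \<open>d = H 1 - H 0\<close>, the affine function \<open>x \<mapsto> H 0 + d * (x - 1)\<close> lies below \<open>x \<mapsto> H (sqrt x)\<close>: beyond
  \<open>x = 1\<close> the chord through \<open>0\<close> and \<open>1\<close> already does, by convexity, and up to \<open>x = 1\<close> the affine function
  stays below \<open>H 0\<close>, the smallest value of \<open>H\<close>.
\<close>

lemma energy_coercive: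
  "H 0 - (H 1 - H 0) + (H 1 - H 0) * (norm Q)\<^sup>2 / real CARD('n) \<le> energy (Q :: real ^ 'n ^ 'm)"
proof -
  interpret prob_space "uniform_sphere :: (real ^ 'n) measure"
    by (rule prob_space_uniform_sphere)
  define d where "d = H 1 - H 0"
  have d: "d > 0"
    using H_less[of 0 1] by (simp add: d_def)
  have low: "H 0 - d + d * t\<^sup>2 \<le> H t" if "0 \<le> t" for t
  proof (cases "t \<le> 1")
    case True
    then have "d * t\<^sup>2 \<le> d"
      using that d by (simp add: mult_left_le power_le_one)
    with H_le[of 0 t] that show ?thesis by simp
  next
    case False
    then have t: "1 \<le> t\<^sup>2" "0 < t\<^sup>2"
      by simp_all
    \<comment> \<open>\<open>1\<close> is the convex combination of \<open>0\<close> and \<open>t\<^sup>2\<close> with weight \<open>1 / t\<^sup>2\<close> on the latter.\<close>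
    then have "H 1 \<le> (1 - 1 / t\<^sup>2) * H 0 + (1 / t\<^sup>2) * H t"
      using that by (intro H_convex_comb) (auto simp: divide_le_eq_1)
    then have "t\<^sup>2 * H 1 \<le> t\<^sup>2 * ((1 - 1 / t\<^sup>2) * H 0 + (1 / t\<^sup>2) * H t)"
      using t by (intro mult_left_mono) auto
    also have "\<dots> = (t\<^sup>2 - 1) * H 0 + H t"
      using t by (simp add: algebra_simps)
    finally show ?thesis
      using H_le[of 0 1] by (simp add: d_def algebra_simps)
  qed
  have "H 0 - d + d * ((norm Q)\<^sup>2 / real CARD('n)) = (LINT z|uniform_sphere. H 0 - d + d * (norm (Q *v z))\<^sup>2)"
    using prob_space by (simp add: integrable_sphere_norm_sq)
  also have "\<dots> \<le> energy Q"
    unfolding energy_def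
    by (rule integral_mono) (auto intro!: integrable_sphere_norm_sq integrable_H low)
  finally show ?thesis
    by (simp add: d_def)
qed

lemma minimizer_exists:
  fixes G :: "real ^ 'n ^ 'm"
  obtains P where "\<And>Q. energy P - P \<bullet> G \<le> energy Q - Q \<bullet> G"
proof -
  define d where "d = H 1 - H 0"
  define N where "N = real CARD('n)"
  have N: "N > 0"
    by (simp add: N_def)
  have d: "d > 0"
    using H_less[of 0 1] by (simp add: d_def)
  \<comment> \<open>Beyond this radius the quadratic lower bound on the energy dominates the linear term.\<close>
  define R where "R = (norm G + d) * N / d + 1"
  have R: "R \<ge> 1"
    using d N by (simp add: R_def)
  have far: "energy (0 :: real ^ 'n ^ 'm) - 0 \<bullet> G \<le> energy Q - Q \<bullet> G" if "norm Q > R" for Q :: "real ^ 'n ^ 'm"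
  proof -
    have "energy (0 :: real ^ 'n ^ 'm) = H 0"
      using prob_space.prob_space[OF prob_space_uniform_sphere[where 'a = "real ^ 'n"]]
      by (simp add: energy_def)
    moreover have "Q \<bullet> G \<le> norm Q * norm G"
      by (rule norm_cauchy_schwarz)
    moreover have "norm Q * norm G + d \<le> d * (norm Q)\<^sup>2 / N"
    proof -
      have "norm G + d = d * (R - 1) / N"
        using d N by (simp add: R_def)
      also have "\<dots> \<le> d * norm Q / N"
        using that d N by (intro divide_right_mono mult_left_mono) auto
      finally have "norm Q * (norm G + d) \<le> norm Q * (d * norm Q / N)"
        by (rule mult_left_mono) simp
      moreover have "d * 1 \<le> d * norm Q"
        using that R d by (intro mult_left_mono) auto
      ultimately show ?thesis
        by (simp add: power2_eq_square algebra_simps)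
    qed
    moreover have "H 0 - d + d * (norm Q)\<^sup>2 / N \<le> energy Q"
      using energy_coercive[of Q] by (simp add: d_def N_def)
    ultimately show ?thesis
      by simp
  qed
  have cont: "continuous_on (cball 0 R) (\<lambda>Q :: real ^ 'n ^ 'm. energy Q - Q \<bullet> G)"
    by (intro continuous_intros continuous_on_subset[OF convex_on_continuous[OF open_UNIV convex_energy]]) simp
  have "cball (0 :: real ^ 'n ^ 'm) R \<noteq> {}"
    using R by simp
  from continuous_attains_inf[OF compact_cball this cont] obtain P :: "real ^ 'n ^ 'm" where
    P: "\<And>Q. Q \<in> cball 0 R \<Longrightarrow> energy P - P \<bullet> G \<le> energy Q - Q \<bullet> G"
    by blast
  have "energy P - P \<bullet> G \<le> energy Q - Q \<bullet> G" for Q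
  proof (cases "norm Q \<le> R")
    case False
    have "energy P - P \<bullet> G \<le> energy (0 :: real ^ 'n ^ 'm) - 0 \<bullet> G"
      using R by (intro P) simp
    with far[of Q] False show ?thesis by simp
  qed (use P in simp)
  with that show thesis .
qed

text \<open>
  A competitor that is merely as good as a minimiser coincides with it; symmetries and rearrangements
  of a minimiser enter the argument as such competitors.
\<close>

lemma minimizer_unique:
  fixes G P P' :: "real ^ 'n ^ 'm"
  assumes P: "\<And>Q. energy P - P \<bullet> G \<le> energy Q - Q \<bullet> G"
    and P': "energy P' - P' \<bullet> G \<le> energy P - P \<bullet> G"
  shows "P' = P"
proof (rule ccontr)
  assume "P' \<noteq> P"
  define R where "R = (1/2) *\<^sub>R P' + (1/2) *\<^sub>R P"
  have "energy R < (energy P' + energy P) / 2"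
    unfolding R_def using \<open>P' \<noteq> P\<close> by (rule energy_midpoint_less)
  moreover have "R \<bullet> G = (P' \<bullet> G + P \<bullet> G) / 2"
    by (simp add: R_def inner_add_left)
  ultimately have "energy R - R \<bullet> G < energy P - P \<bullet> G"
    using P' by (simp add: field_simps)
  with P[of R] show False
    by simp
qed

text \<open>
  The source of every symmetry of the energy: an isometry acting on the domain is absorbed by the
  invariance of the sphere measure, one acting on the codomain by the norm.
\<close>

lemma energy_isometry_right:
  fixes Q Q' :: "real ^ 'n ^ 'm"
  assumes f: "orthogonal_transformation f"
    and eq: "\<And>z. norm (Q' *v z) = norm (Q *v f z)"
  shows "energy Q' = energy Q"
  unfolding energy_def eq
  by (rule integral_uniform_sphere_orthogonal[OF f]) measurable

lemma energy_orthogonal: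
  fixes Q :: "real ^ 'n ^ 'm"
  assumes U: "orthogonal_matrix U" and V: "orthogonal_matrix V"
  shows "energy (U ** Q ** V) = energy Q"
proof (rule energy_isometry_right)
  show "orthogonal_transformation ((*v) V)"
    using V by (simp add: orthogonal_transformation_matrix)
  have "orthogonal_transformation ((*v) U)"
    using U by (simp add: orthogonal_transformation_matrix)
  then show "norm (U ** Q ** V *v z) = norm (Q *v (V *v z))" for z
    by (simp add: matrix_vector_mul_assoc[symmetric] orthogonal_transformation_norm)
qed

end

section \<open>Singular value decomposition\<close>

definition orthonormal_family :: "nat \<Rightarrow> (nat \<Rightarrow> 'a::real_inner) \<Rightarrow> bool" where
  "orthonormal_family p u \<longleftrightarrow> (\<forall>i\<in>{1..p}. \<forall>j\<in>{1..p}. u i \<bullet> u j = (if i = j then 1 else 0))"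

lemma unit_orthogonal_exists:
  fixes u :: "nat \<Rightarrow> 'a::euclidean_space"
  assumes "p < DIM('a)"
  obtains x where "norm x = 1" "\<And>i. i \<in> {1..p} \<Longrightarrow> u i \<bullet> x = 0"
proof -
  have "dim (u ` {1..p}) \<le> card (u ` {1..p})"
    by (rule dim_le_card[OF span_superset]) simp
  also have "\<dots> \<le> p"
    using card_image_le[of "{1..p}" u] by simp
  finally have "dim (u ` {1..p}) < DIM('a)"
    using assms by simp
  then obtain y where y: "y \<noteq> 0" "\<And>v. v \<in> span (u ` {1..p}) \<Longrightarrow> orthogonal y v"
    using orthogonal_to_subspace_exists by blast
  show thesis
  proof
    show "norm (sgn y) = 1"
      using y by (simp add: norm_sgn)
    show "u i \<bullet> sgn y = 0" if "i \<in> {1..p}" for i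
      using y(2)[OF span_base[of "u i"]] that
      by (simp add: sgn_div_norm orthogonal_def inner_commute)
  qed
qed

lemma orthonormal_family_snoc:
  assumes "orthonormal_family p u" "norm x = 1" "\<And>i. i \<in> {1..p} \<Longrightarrow> u i \<bullet> x = 0"
  shows "orthonormal_family (Suc p) (u(Suc p := x))"
  using assms by (auto simp: orthonormal_family_def norm_eq_1 inner_commute le_Suc_eq)

lemma orthonormal_family_extend:
  fixes u :: "nat \<Rightarrow> 'a::euclidean_space"
  assumes "orthonormal_family p u" "p \<le> q" "q \<le> DIM('a)"
  obtains u' where "orthonormal_family q u'" "\<And>i. i \<in> {1..p} \<Longrightarrow> u' i = u i"
proof -
  have "\<exists>u'. orthonormal_family q u' \<and> (\<forall>i\<in>{1..p}. u' i = u i)"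
    using assms(2,3)
  proof (induction q rule: dec_induct)
    case base
    with assms(1) show ?case by blast
  next
    case (step q)
    then obtain u' where u': "orthonormal_family q u'" "\<forall>i\<in>{1..p}. u' i = u i"
      by auto
    obtain x where "norm x = 1" "\<And>i. i \<in> {1..q} \<Longrightarrow> u' i \<bullet> x = 0"
      using unit_orthogonal_exists[of q u'] step by auto
    then have "orthonormal_family (Suc q) (u'(Suc q := x))"
      by (rule orthonormal_family_snoc[OF u'(1)])
    moreover have "\<forall>i\<in>{1..p}. (u'(Suc q := x)) i = u i"
      using u'(2) step.hyps by auto
    ultimately show ?case
      by blast
  qed
  with that show thesis by blast
qed

lemma compact_unit_orthogonal:
  fixes u :: "nat \<Rightarrow> 'a::euclidean_space"
  shows "compact {x. norm x = 1 \<and> (\<forall>i\<in>{1..p}. u i \<bullet> x = 0)}"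
proof -
  have "{x. norm x = 1 \<and> (\<forall>i\<in>{1..p}. u i \<bullet> x = 0)} = sphere 0 1 \<inter> (\<Inter>i\<in>{1..p}. {x. u i \<bullet> x = 0})"
    by auto
  also have "compact \<dots>"
    by (intro compact_Int_closed compact_sphere closed_INT ballI closed_hyperplane)
  finally show ?thesis .
qed

text \<open>
  Testing against \<open>sgn y\<close> shows that the maximum of \<open>x \<bullet> y\<close> over the unit vectors of a cone containing
  \<open>y\<close> is \<open>norm y\<close>; a maximiser \<open>u\<close> is then an equality case of the Cauchy-Schwarz inequality.
\<close>

lemma unit_maximizer_parallel:
  fixes y u :: "'a::real_inner"
  assumes u: "norm u = 1" and y: "y \<in> A"
    and scale: "\<And>t x. x \<in> A \<Longrightarrow> t *\<^sub>R x \<in> A"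
    and max: "\<And>x. x \<in> A \<Longrightarrow> norm x = 1 \<Longrightarrow> x \<bullet> y \<le> u \<bullet> y"
    and nonneg: "0 \<le> u \<bullet> y"
  shows "y = (u \<bullet> y) *\<^sub>R u"
proof -
  have "norm y \<le> u \<bullet> y"
  proof (cases "y = 0")
    case False
    then have "norm y = sgn y \<bullet> y"
      by (simp add: sgn_div_norm dot_square_norm power2_eq_square)
    also have "\<dots> \<le> u \<bullet> y"
      using False y scale by (intro max) (auto simp: sgn_div_norm)
    finally show ?thesis .
  qed simp
  then have "(norm y)\<^sup>2 \<le> (u \<bullet> y)\<^sup>2"
    by (intro power_mono) auto
  moreover have "(norm (y - (u \<bullet> y) *\<^sub>R u))\<^sup>2 = (norm y)\<^sup>2 - (u \<bullet> y)\<^sup>2"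
  proof -
    have uu: "u \<bullet> u = 1"
      using u by (simp add: norm_eq_1)
    have commute: "y \<bullet> u = u \<bullet> y"
      by (rule inner_commute)
    show ?thesis
      unfolding power2_norm_eq_inner inner_diff_left inner_diff_right inner_scaleR_left
        inner_scaleR_right commute uu
      by algebra
  qed
  ultimately have "(norm (y - (u \<bullet> y) *\<^sub>R u))\<^sup>2 \<le> 0"
    by simp
  then show ?thesis
    by simp
qed

text \<open>
  The next pair of singular vectors maximises \<open>x \<bullet> (G *v y)\<close> over unit vectors \<open>x\<close> and \<open>y\<close> orthogonal to
  the previous left and right singular vectors. The previous pairs being singular pairs, \<open>G\<close> and its
  transpose map these two orthogonal complements into each other, so that
  \<open>unit_maximizer_parallel\<close> applies to either variable with the other one held fixed.
\<close>

lemma singular_vectors_exist: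
  fixes G :: "real ^ 'n ^ 'm"
  assumes "p \<le> CARD('m)" "p \<le> CARD('n)"
  shows "\<exists>u v s. orthonormal_family p u \<and> orthonormal_family p v \<and>
    (\<forall>i\<in>{1..p}. 0 \<le> s i \<and> G *v v i = s i *\<^sub>R u i \<and> u i v* G = s i *\<^sub>R v i)"
  using assms
proof (induction p)
  case 0
  then show ?case by (simp add: orthonormal_family_def)
next
  case (Suc p)
  then obtain u v s where u: "orthonormal_family p u" and v: "orthonormal_family p v"
    and s_all: "\<forall>i\<in>{1..p}. 0 \<le> s i \<and> G *v v i = s i *\<^sub>R u i \<and> u i v* G = s i *\<^sub>R v i"
    by fastforce
  from s_all have s: "0 \<le> s i \<and> G *v v i = s i *\<^sub>R u i \<and> u i v* G = s i *\<^sub>R v i" if "i \<in> {1..p}" for i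
    using that by blast
  have adj: "x \<bullet> (G *v y) = (x v* G) \<bullet> y" for x y
    by (simp add: dot_lmul_matrix)
  let ?A = "{x. \<forall>i\<in>{1..p}. u i \<bullet> x = 0}" and ?B = "{y. \<forall>i\<in>{1..p}. v i \<bullet> y = 0}"
  let ?SA = "{x. norm x = 1 \<and> (\<forall>i\<in>{1..p}. u i \<bullet> x = 0)}"
  let ?SB = "{y. norm y = 1 \<and> (\<forall>i\<in>{1..p}. v i \<bullet> y = 0)}"
  have GB: "G *v y \<in> ?A" if "y \<in> ?B" for y
    using that s by (auto simp: adj)
  have GA: "x v* G \<in> ?B" if "x \<in> ?A" for x
  proof -
    have "v i \<bullet> (x v* G) = 0" if "i \<in> {1..p}" for i
      using \<open>x \<in> ?A\<close> s[OF that] that adj[of x "v i"] by (simp add: inner_commute)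
    then show ?thesis by simp
  qed
  have "compact (?SA \<times> ?SB)"
    by (intro compact_Times compact_unit_orthogonal)
  moreover have "?SA \<times> ?SB \<noteq> {}"
  proof -
    have dims: "p < DIM(real ^ 'm)" "p < DIM(real ^ 'n)"
      using Suc.prems by simp_all
    obtain x where "norm x = 1" "\<And>i. i \<in> {1..p} \<Longrightarrow> u i \<bullet> x = 0"
      using unit_orthogonal_exists[OF dims(1)] by blast
    moreover obtain y where "norm y = 1" "\<And>i. i \<in> {1..p} \<Longrightarrow> v i \<bullet> y = 0"
      using unit_orthogonal_exists[OF dims(2)] by blast
    ultimately have "(x, y) \<in> ?SA \<times> ?SB"
      by simp
    then show ?thesis by blast
  qed
  moreover have "continuous_on (?SA \<times> ?SB) (\<lambda>z. fst z \<bullet> (G *v snd z))"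
  proof -
    have "continuous_on (?SA \<times> ?SB) (\<lambda>z. G *v snd z)"
      by (rule continuous_on_compose2[of UNIV "(*v) G"])
         (auto intro: linear_continuous_on continuous_on_snd continuous_on_id simp: linear_linear)
    then show ?thesis
      by (intro continuous_intros)
  qed
  ultimately have "\<exists>z\<in>?SA \<times> ?SB. \<forall>w\<in>?SA \<times> ?SB. fst w \<bullet> (G *v snd w) \<le> fst z \<bullet> (G *v snd z)"
    by (rule continuous_attains_sup)
  then obtain z where z: "z \<in> ?SA \<times> ?SB"
    and z_max: "\<forall>w\<in>?SA \<times> ?SB. fst w \<bullet> (G *v snd w) \<le> fst z \<bullet> (G *v snd z)"
    by (rule bexE)
  define a b where "a = fst z" and "b = snd z"
  have a: "a \<in> ?SA" and b: "b \<in> ?SB"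
    using z by (auto simp: a_def b_def)
  have max: "x \<bullet> (G *v y) \<le> a \<bullet> (G *v b)" if "x \<in> ?SA" "y \<in> ?SB" for x y
    using z_max[rule_format, of "(x, y)"] that by (simp add: a_def b_def)
  define t where "t = a \<bullet> (G *v b)"
  have t: "0 \<le> t"
    using max[of "- a" b] a b by (simp add: t_def)
  have Gb: "G *v b = t *\<^sub>R a"
    unfolding t_def
  proof (rule unit_maximizer_parallel[where A = ?A])
    show "x \<bullet> (G *v b) \<le> a \<bullet> (G *v b)" if "x \<in> ?A" "norm x = 1" for x
      using that by (intro max b) auto
    show "G *v b \<in> ?A"
      using b by (intro GB) auto
  qed (use a t in \<open>auto simp: t_def\<close>)
  have t': "t = b \<bullet> (a v* G)"
    by (simp add: t_def adj inner_commute)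
  have Ga: "a v* G = t *\<^sub>R b"
    unfolding t'
  proof (rule unit_maximizer_parallel[where A = ?B])
    show "y \<bullet> (a v* G) \<le> b \<bullet> (a v* G)" if "y \<in> ?B" "norm y = 1" for y
      using max[of a y] a that by (simp add: adj inner_commute)
    show "a v* G \<in> ?B"
      using a by (intro GA) auto
  qed (use b t in \<open>auto simp: t'\<close>)
  have "orthonormal_family (Suc p) (u(Suc p := a))" "orthonormal_family (Suc p) (v(Suc p := b))"
    using u v a b by (auto intro!: orthonormal_family_snoc)
  moreover have "\<forall>i\<in>{1..Suc p}. 0 \<le> (s(Suc p := t)) i \<and>
      G *v (v(Suc p := b)) i = (s(Suc p := t)) i *\<^sub>R (u(Suc p := a)) i \<and>
      (u(Suc p := a)) i v* G = (s(Suc p := t)) i *\<^sub>R (v(Suc p := b)) i"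
    using s t Gb Ga by auto
  ultimately show ?case by blast
qed

lemma orthogonal_matrix_orthonormal_family:
  fixes u :: "nat \<Rightarrow> real ^ 'm" and r :: "'m \<Rightarrow> nat"
  assumes u: "orthonormal_family CARD('m) u" and r: "bij_betw r UNIV {1..CARD('m)}"
  shows "orthogonal_matrix (\<chi> i j. u (r j) $ i)"
proof -
  have "r j \<in> {1..CARD('m)}" for j
    using r by (auto simp: bij_betw_def)
  moreover have "r i = r j \<longleftrightarrow> i = j" for i j
    using r by (auto simp: bij_betw_def inj_on_def)
  ultimately have "u (r i) \<bullet> u (r j) = (if i = j then 1 else 0)" for i j
    using u unfolding orthonormal_family_def by metis
  then show ?thesis
    by (simp add: orthogonal_matrix vec_eq_iff matrix_matrix_mult_def transpose_def mat_def inner_vec_def)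
qed

text \<open>
  Full decomposition with square orthogonal factors: \<open>min m n\<close> singular pairs are completed to
  orthonormal bases on both sides. Every entry of \<open>transpose U ** G ** V\<close> has its row or its column
  index among the singular pairs, so the completing vectors impose no further condition.
\<close>

theorem singular_value_decomposition:
  fixes G :: "real ^ 'n ^ 'm" and r :: "'m \<Rightarrow> nat" and c :: "'n \<Rightarrow> nat"
  assumes r: "bij_betw r UNIV {1..CARD('m)}" and c: "bij_betw c UNIV {1..CARD('n)}"
  obtains U V \<sigma> where "orthogonal_matrix U" "orthogonal_matrix V"
    "\<And>i. i \<in> {1..min CARD('m) CARD('n)} \<Longrightarrow> 0 \<le> \<sigma> i"
    "G = U ** rect_diag r c \<sigma> ** transpose V"
proof -
  let ?k = "min CARD('m) CARD('n)"
  have k: "?k \<le> CARD('m)" "?k \<le> CARD('n)"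
    by simp_all
  obtain u0 v0 s where u0: "orthonormal_family ?k u0" and v0: "orthonormal_family ?k v0"
    and s_all: "\<forall>i\<in>{1..?k}. 0 \<le> s i \<and> G *v v0 i = s i *\<^sub>R u0 i \<and> u0 i v* G = s i *\<^sub>R v0 i"
    using singular_vectors_exist[OF k, of G] by blast
  obtain u where u: "orthonormal_family CARD('m) u" and uu: "\<And>i. i \<in> {1..?k} \<Longrightarrow> u i = u0 i"
    using orthonormal_family_extend[OF u0, of "CARD('m)"] by auto
  obtain v where v: "orthonormal_family CARD('n) v" and vv: "\<And>i. i \<in> {1..?k} \<Longrightarrow> v i = v0 i"
    using orthonormal_family_extend[OF v0, of "CARD('n)"] by auto
  have s: "0 \<le> s i \<and> G *v v i = s i *\<^sub>R u i \<and> u i v* G = s i *\<^sub>R v i" if "i \<in> {1..?k}" for i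
    using s_all that by (simp add: uu vv)
  define U where "U = (\<chi> i j. u (r j) $ i)"
  define V where "V = (\<chi> i j. v (c j) $ i)"
  have U: "orthogonal_matrix U" and V: "orthogonal_matrix V"
    using orthogonal_matrix_orthonormal_family[OF u r] orthogonal_matrix_orthonormal_family[OF v c]
    by (simp_all add: U_def V_def)
  have adj: "x \<bullet> (G *v y) = (x v* G) \<bullet> y" for x y
    by (simp add: dot_lmul_matrix)
  have entry: "u i \<bullet> (G *v v j) = (if i = j then s i else 0)"
    if i: "i \<in> {1..CARD('m)}" and j: "j \<in> {1..CARD('n)}" for i j
  proof (cases "j \<le> ?k")
    case True
    then have "G *v v j = s j *\<^sub>R u j" "j \<in> {1..CARD('m)}"
      using s[of j] j by auto
    then show ?thesis
      using u i by (simp add: orthonormal_family_def)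
  next
    case False
    then have "i \<in> {1..?k}"
      using i j by auto
    then have "u i v* G = s i *\<^sub>R v i" "i \<in> {1..CARD('n)}"
      using s[of i] by auto
    then show ?thesis
      using v j by (simp add: adj orthonormal_family_def)
  qed
  have rc: "r i \<in> {1..CARD('m)}" "c j \<in> {1..CARD('n)}" for i j
    using r c by (auto simp: bij_betw_def)
  have UGV: "transpose U ** G ** V = rect_diag r c s"
  proof -
    have "(transpose U ** (G ** V)) $ i $ j = u (r i) \<bullet> (G *v v (c j))" for i j
      by (simp add: U_def V_def transpose_def matrix_matrix_mult_def matrix_vector_mult_def inner_vec_def)
    then show ?thesis
      using entry[OF rc] by (simp add: vec_eq_iff rect_diag_def matrix_mul_assoc)
  qed
  have "U ** rect_diag r c s ** transpose V = (U ** transpose U) ** G ** (V ** transpose V)"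
    by (simp add: UGV[symmetric] matrix_mul_assoc)
  then have "G = U ** rect_diag r c s ** transpose V"
    using U V by (simp add: orthogonal_matrix_def)
  with that[OF U V] s show thesis
    by auto
qed

section \<open>Pairs of entries, ratios and inner products of matrices\<close>

text \<open>
  The pair \<open>(u, v)\<close> has the length of \<open>(a, b)\<close> and the direction of \<open>(x, y)\<close>. As the direction of
  \<open>(x, y)\<close> lies between that of \<open>(a, b)\<close> and the diagonal, \<open>u\<^sup>2\<close> lies between \<open>b\<^sup>2\<close> and \<open>a\<^sup>2\<close>, which
  makes \<open>(u\<^sup>2, v\<^sup>2)\<close> a convex combination of \<open>(a\<^sup>2, b\<^sup>2)\<close> and \<open>(b\<^sup>2, a\<^sup>2)\<close>.
\<close>

lemma rotated_pair:
  fixes a b x y :: real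
  assumes "0 \<le> b" "0 < y" "y \<le> x" "b * x < a * y"
  obtains u v t where "0 \<le> t" "t \<le> 1" "u\<^sup>2 = (1 - t) * a\<^sup>2 + t * b\<^sup>2" "v\<^sup>2 = (1 - t) * b\<^sup>2 + t * a\<^sup>2"
    "a * x + b * y \<le> u * x + v * y" "u * y = v * x"
proof -
  define R where "R = sqrt (a\<^sup>2 + b\<^sup>2)"
  define N where "N = sqrt (x\<^sup>2 + y\<^sup>2)"
  have R: "R\<^sup>2 = a\<^sup>2 + b\<^sup>2" "0 \<le> R" and N2: "N\<^sup>2 = x\<^sup>2 + y\<^sup>2"
    by (simp_all add: R_def N_def)
  have N: "0 < N"
    using assms by (simp add: N_def sum_power2_gt_zero_iff)
  define u v where "u = R * x / N" and "v = R * y / N"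
  have "b * y \<le> b * x"
    using assms by (intro mult_left_mono) auto
  with assms have "b * y < a * y"
    by linarith
  with assms have ab: "b < a"
    by simp
  then have ab2: "b\<^sup>2 < a\<^sup>2"
    using assms by (intro power_strict_mono) auto
  have u2: "u\<^sup>2 * N\<^sup>2 = (a\<^sup>2 + b\<^sup>2) * x\<^sup>2"
    using N by (simp add: u_def power_mult_distrib power_divide R)
  have v2: "v\<^sup>2 * N\<^sup>2 = (a\<^sup>2 + b\<^sup>2) * y\<^sup>2"
    using N by (simp add: v_def power_mult_distrib power_divide R)
  have sum2: "u\<^sup>2 + v\<^sup>2 = a\<^sup>2 + b\<^sup>2"
  proof -
    have "(u\<^sup>2 + v\<^sup>2) * N\<^sup>2 = (a\<^sup>2 + b\<^sup>2) * N\<^sup>2"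
      using u2 v2 by (simp add: N2 algebra_simps)
    then show ?thesis
      using N by simp
  qed
  have "u\<^sup>2 \<le> a\<^sup>2"
  proof -
    have "(b * x)\<^sup>2 \<le> (a * y)\<^sup>2"
      using assms by (intro power_mono) auto
    then have "u\<^sup>2 * N\<^sup>2 \<le> a\<^sup>2 * N\<^sup>2"
      unfolding u2 unfolding N2 by (simp add: algebra_simps)
    then show ?thesis
      using N by simp
  qed
  have "b\<^sup>2 \<le> u\<^sup>2"
  proof -
    have "(b * y)\<^sup>2 \<le> (a * x)\<^sup>2"
      using assms ab by (intro power_mono mult_mono) auto
    then have "b\<^sup>2 * N\<^sup>2 \<le> u\<^sup>2 * N\<^sup>2"
      unfolding u2 unfolding N2 by (simp add: algebra_simps)
    then show ?thesis
      using N by simp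
  qed
  define t where "t = (a\<^sup>2 - u\<^sup>2) / (a\<^sup>2 - b\<^sup>2)"
  have t: "t * (a\<^sup>2 - b\<^sup>2) = a\<^sup>2 - u\<^sup>2"
    using ab2 by (simp add: t_def)
  show thesis
  proof
    show "0 \<le> t" "t \<le> 1"
      using ab2 \<open>u\<^sup>2 \<le> a\<^sup>2\<close> \<open>b\<^sup>2 \<le> u\<^sup>2\<close> by (simp_all add: t_def)
    show "u\<^sup>2 = (1 - t) * a\<^sup>2 + t * b\<^sup>2" "v\<^sup>2 = (1 - t) * b\<^sup>2 + t * a\<^sup>2"
      using t sum2 by (simp_all add: algebra_simps)
    show "u * y = v * x"
      by (simp add: u_def v_def)
    \<comment> \<open>Lagrange's identity, hence the Cauchy-Schwarz inequality.\<close>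
    have "(a * x + b * y)\<^sup>2 = (R * N)\<^sup>2 - (a * y - b * x)\<^sup>2"
      unfolding power_mult_distrib R N2 by algebra
    then have "(a * x + b * y)\<^sup>2 \<le> (R * N)\<^sup>2"
      by simp
    then have "a * x + b * y \<le> R * N"
      by (rule power2_le_imp_le) (use R(2) N in simp)
    also have "R * N = R * N\<^sup>2 / N"
      using N by (simp add: power2_eq_square)
    also have "\<dots> = u * x + v * y"
      unfolding N2 by (simp add: u_def v_def add_divide_distrib power2_eq_square distrib_left)
    finally show "a * x + b * y \<le> u * x + v * y" .
  qed
qed

text \<open>
  The comparison of ratios without division: \<open>cross\<close> is the inequality between the fractions after
  clearing denominators, and \<open>tie\<close> settles \<open>x = y = 0\<close>, where the right-hand side is \<open>1\<close>.
\<close>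

lemma ext_ratio_mono:
  assumes "0 \<le> x" "0 \<le> y" "0 \<le> a" "0 \<le> b" "y \<le> x"
    and ord: "b \<le> a" and tie: "x \<le> y \<Longrightarrow> a = b" and cross: "0 < y \<Longrightarrow> a * y \<le> b * x"
  shows "ext_ratio a b \<le> ext_ratio x y"
proof (cases "y = 0")
  case True
  then show ?thesis
    using assms by (auto simp: ext_ratio_def one_ereal_def)
next
  case False
  then have y: "0 < y"
    using assms by simp
  show ?thesis
  proof (cases "b = 0")
    case True
    with cross[OF y] assms y have "a = 0"
      by (auto simp: mult_le_0_iff)
    with True y assms show ?thesis
      by (simp add: ext_ratio_def one_ereal_def)
  next
    case False
    with assms y cross[OF y] show ?thesis
      by (simp add: ext_ratio_def field_simps)
  qed
qed

lemma inner_matrix_mult_left: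
  fixes A :: "real ^ 'k ^ 'm" and X :: "real ^ 'n ^ 'k" and Y :: "real ^ 'n ^ 'm"
  shows "(A ** X) \<bullet> Y = X \<bullet> (transpose A ** Y)"
proof -
  have "(A ** X) \<bullet> Y = (\<Sum>i\<in>UNIV. \<Sum>j\<in>UNIV. \<Sum>l\<in>UNIV. A $ i $ l * X $ l $ j * Y $ i $ j)"
    by (simp add: inner_vec_def matrix_matrix_mult_def sum_distrib_right)
  also have "\<dots> = (\<Sum>i\<in>UNIV. \<Sum>l\<in>UNIV. \<Sum>j\<in>UNIV. A $ i $ l * X $ l $ j * Y $ i $ j)"
    by (intro sum.cong refl sum.swap)
  also have "\<dots> = (\<Sum>l\<in>UNIV. \<Sum>i\<in>UNIV. \<Sum>j\<in>UNIV. A $ i $ l * X $ l $ j * Y $ i $ j)"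
    by (rule sum.swap)
  also have "\<dots> = (\<Sum>l\<in>UNIV. \<Sum>j\<in>UNIV. \<Sum>i\<in>UNIV. A $ i $ l * X $ l $ j * Y $ i $ j)"
    by (intro sum.cong refl sum.swap)
  also have "\<dots> = X \<bullet> (transpose A ** Y)"
    by (simp add: inner_vec_def matrix_matrix_mult_def transpose_def sum_distrib_left mult_ac)
  finally show ?thesis .
qed

lemma inner_transpose:
  fixes X Y :: "real ^ 'n ^ 'm"
  shows "transpose X \<bullet> transpose Y = X \<bullet> Y"
  unfolding inner_vec_def transpose_def by (simp add: sum.swap[of _ "UNIV :: 'n set"])

lemma inner_matrix_mult_right:
  fixes X :: "real ^ 'k ^ 'm" and B :: "real ^ 'n ^ 'k" and Y :: "real ^ 'n ^ 'm"
  shows "(X ** B) \<bullet> Y = X \<bullet> (Y ** transpose B)"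
  using inner_matrix_mult_left[of "transpose B" "transpose X" "transpose Y"]
  by (metis inner_transpose matrix_transpose_mul transpose_transpose)

section \<open>Diagonal targets\<close>

locale diagonal_curvature = isotropic_curvature H
  for H :: "real \<Rightarrow> real" +
  fixes r :: "'m::finite \<Rightarrow> nat" and c :: "'n::finite \<Rightarrow> nat" and k :: nat
  assumes rows: "bij_betw r UNIV {1..CARD('m)}"
    and cols: "bij_betw c UNIV {1..CARD('n)}"
    and k_def: "k = min CARD('m) CARD('n)"
begin

abbreviation D :: "(nat \<Rightarrow> real) \<Rightarrow> real ^ 'n ^ 'm" where
  "D \<equiv> rect_diag r c"

definition col_of :: "nat \<Rightarrow> 'n" where "col_of = inv c"
definition row_of :: "nat \<Rightarrow> 'm" where "row_of = inv r"

lemma col_of_c [simp]: "col_of (c j) = j" and row_of_r [simp]: "row_of (r i) = i"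
  using rows cols by (simp_all add: col_of_def row_of_def bij_betw_def)

lemma c_col_of: "c (col_of a) = a" if "a \<in> {1..CARD('n)}"
  using cols that by (simp add: col_of_def bij_betw_def f_inv_into_f)

lemma r_row_of: "r (row_of a) = a" if "a \<in> {1..CARD('m)}"
  using rows that by (simp add: row_of_def bij_betw_def f_inv_into_f)

lemma r_range: "r i \<in> {1..CARD('m)}" and c_range: "c j \<in> {1..CARD('n)}"
  using rows cols by (auto simp: bij_betw_def)

lemma index_range: "a \<in> {1..CARD('m)}" "a \<in> {1..CARD('n)}" if "a \<in> {1..k}"
  using that by (auto simp: k_def)

lemma D_entry: "D s $ row_of a $ col_of a = s a" if "a \<in> {1..k}"
  using r_row_of[OF index_range(1)[OF that]] c_col_of[OF index_range(2)[OF that]]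
  by (simp add: rect_diag_def)

lemma sum_diagonal:
  fixes g :: "nat \<Rightarrow> real"
  shows "(\<Sum>i\<in>UNIV. if r i \<in> {1..CARD('n)} then g (r i) else 0) = sum g {1..k}"
proof -
  have "(\<Sum>i\<in>UNIV. if r i \<in> {1..CARD('n)} then g (r i) else 0) =
      (\<Sum>a\<in>{1..CARD('m)}. if a \<in> {1..CARD('n)} then g a else 0)"
    using sum.reindex_bij_betw[OF rows, of "\<lambda>a. if a \<in> {1..CARD('n)} then g a else 0"] .
  also have "\<dots> = sum g ({1..CARD('m)} \<inter> {1..CARD('n)})"
    by (simp only: sum.inter_restrict finite_atLeastAtMost)
  also have "{1..CARD('m)} \<inter> {1..CARD('n)} = {1..k}"
    by (auto simp: k_def)
  finally show ?thesis .
qed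

lemma sum_row:
  fixes h :: "'n \<Rightarrow> real"
  shows "(\<Sum>j\<in>UNIV. if r i = c j then h j else 0) = (if r i \<in> {1..CARD('n)} then h (col_of (r i)) else 0)"
proof -
  have "(\<Sum>j\<in>UNIV. if r i = c j then h j else 0) =
      (\<Sum>a\<in>{1..CARD('n)}. if r i = a then h (col_of a) else 0)"
    using sum.reindex_bij_betw[OF cols, of "\<lambda>a. if r i = a then h (col_of a) else 0"]
    by (simp only: col_of_c)
  also have "\<dots> = (if r i \<in> {1..CARD('n)} then h (col_of (r i)) else 0)"
    by (rule sum.delta') simp
  finally show ?thesis .
qed

lemma inner_D: "D s \<bullet> D t = (\<Sum>a\<in>{1..k}. s a * t a)"
proof -
  have "D s \<bullet> D t = (\<Sum>i\<in>UNIV. \<Sum>j\<in>UNIV. if r i = c j then s (r i) * t (r i) else 0)"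
    by (auto simp: inner_vec_def rect_diag_def intro!: sum.cong)
  then show ?thesis
    using sum_diagonal[of "\<lambda>a. s a * t a"] by (simp only: sum_row)
qed

text \<open>
  The energy of a diagonal matrix thus depends only on the squares of its entries, and symmetrically
  so, because the coordinates of a uniform point are exchangeable.
\<close>

lemma norm_D_mult: "(norm (D s *v z))\<^sup>2 = (\<Sum>a\<in>{1..k}. (s a)\<^sup>2 * (z $ col_of a)\<^sup>2)"
proof -
  have "(D s *v z) $ i = (\<Sum>j\<in>UNIV. if r i = c j then s (r i) * z $ j else 0)" for i
    unfolding matrix_vector_mult_def rect_diag_def by (auto intro!: sum.cong)
  then have "(D s *v z) $ i * (D s *v z) $ i =
      (if r i \<in> {1..CARD('n)} then (s (r i))\<^sup>2 * (z $ col_of (r i))\<^sup>2 else 0)" for i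
    by (simp only: sum_row) (simp add: power2_eq_square)
  then show ?thesis
    using sum_diagonal[of "\<lambda>a. (s a)\<^sup>2 * (z $ col_of a)\<^sup>2"]
    by (simp only: power2_norm_eq_inner inner_vec_def inner_real_def)
qed

lemma energy_D_eqI:
  assumes f: "orthogonal_transformation f"
    and eq: "\<And>z. (\<Sum>a\<in>{1..k}. (t a)\<^sup>2 * (z $ col_of a)\<^sup>2) = (\<Sum>a\<in>{1..k}. (s a)\<^sup>2 * (f z $ col_of a)\<^sup>2)"
  shows "energy (D t) = energy (D s)"
proof (rule energy_isometry_right[OF f])
  show "norm (D t *v z) = norm (D s *v f z)" for z
    using eq[of z] unfolding norm_D_mult[symmetric] by simp
qed

lemma energy_D_swap:
  assumes p: "p \<in> {1..k}" and q: "q \<in> {1..k}"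
  shows "energy (D (s \<circ> Transposition.transpose p q)) = energy (D s)"
proof (rule energy_D_eqI)
  let ?\<tau> = "Transposition.transpose p q"
  let ?\<pi> = "Transposition.transpose (col_of p) (col_of q)"
  show "orthogonal_transformation (\<lambda>z :: real ^ 'n. \<chi> j. z $ ?\<pi> j)"
    by (rule orthogonal_transformation_permute) simp
  fix z :: "real ^ 'n"
  have col_inj: "col_of a = col_of b \<longleftrightarrow> a = b" if "a \<in> {1..k}" "b \<in> {1..k}" for a b
    using that by (metis c_col_of index_range(2))
  have col_\<tau>: "?\<pi> (col_of a) = col_of (?\<tau> a)" if "a \<in> {1..k}" for a
    using col_inj[OF that p] col_inj[OF that q] by (auto simp: Transposition.transpose_def)
  have bij: "bij_betw ?\<tau> {1..k} {1..k}"
    using p q by (intro bij_betw_byWitness[where f' = ?\<tau>]) (auto simp: Transposition.transpose_def)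
  have "(\<Sum>a\<in>{1..k}. (s a)\<^sup>2 * (z $ col_of (?\<tau> a))\<^sup>2) = (\<Sum>a\<in>{1..k}. (s (?\<tau> a))\<^sup>2 * (z $ col_of (?\<tau> (?\<tau> a)))\<^sup>2)"
    by (rule sum.reindex_bij_betw[OF bij, symmetric])
  then show "(\<Sum>a\<in>{1..k}. ((s \<circ> ?\<tau>) a)\<^sup>2 * (z $ col_of a)\<^sup>2) =
      (\<Sum>a\<in>{1..k}. (s a)\<^sup>2 * ((\<chi> j. z $ ?\<pi> j) $ col_of a)\<^sup>2)"
    by (simp add: col_\<tau>)
qed

lemma energy_D_abs: "energy (D (\<lambda>a. \<bar>s a\<bar>)) = energy (D s)"
  by (rule energy_D_eqI[where f = "\<lambda>z. z"]) auto

text \<open>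
  Convexity in the squared entries together with symmetry: moving the squares of two entries towards
  each other while keeping their sum cannot increase the energy.
\<close>

lemma energy_D_mix:
  assumes p: "p \<in> {1..k}" and q: "q \<in> {1..k}" and t: "0 \<le> t" "t \<le> 1"
    and mix: "\<And>a. a \<in> {1..k} \<Longrightarrow>
      (s' a)\<^sup>2 = (1 - t) * (s a)\<^sup>2 + t * (s (Transposition.transpose p q a))\<^sup>2"
  shows "energy (D s') \<le> energy (D s)"
proof -
  let ?s = "s \<circ> Transposition.transpose p q"
  have "energy (D s') \<le> (LINT z|uniform_sphere. (1 - t) * H (norm (D s *v z)) + t * H (norm (D ?s *v z)))"
    unfolding energy_def
  proof (rule integral_mono)
    fix z :: "real ^ 'n"
    have "(norm (D s' *v z))\<^sup>2 = (1 - t) * (norm (D s *v z))\<^sup>2 + t * (norm (D ?s *v z))\<^sup>2"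
      by (simp add: norm_D_mult mix sum_distrib_left sum.distrib[symmetric] distrib_right mult.assoc)
    then show "H (norm (D s' *v z)) \<le> (1 - t) * H (norm (D s *v z)) + t * H (norm (D ?s *v z))"
      using t by (intro H_convex_comb) auto
  qed (auto intro!: integrable_H)
  also have "\<dots> = (1 - t) * energy (D s) + t * energy (D ?s)"
    unfolding energy_def by (simp add: integrable_H)
  also have "\<dots> = energy (D s)"
    by (simp add: energy_D_swap[OF p q] algebra_simps)
  finally show ?thesis .
qed

text \<open>
  A diagonal target is invariant under flipping the signs of row \<open>p\<close> and column \<open>p\<close> simultaneously,
  hence so is the unique minimiser; but an off-diagonal entry in row \<open>p\<close> changes its sign.
\<close>

lemma diagonal_minimizer_exists:
  assumes \<sigma>: "\<And>a. a \<in> {1..k} \<Longrightarrow> 0 \<le> \<sigma> a"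
  obtains s where "\<And>a. a \<in> {1..k} \<Longrightarrow> 0 \<le> s a"
    "\<And>Q. energy (D s) - D s \<bullet> D \<sigma> \<le> energy Q - Q \<bullet> D \<sigma>"
proof -
  obtain P :: "real ^ 'n ^ 'm" where P: "\<And>Q. energy P - P \<bullet> D \<sigma> \<le> energy Q - Q \<bullet> D \<sigma>"
    using minimizer_exists by blast
  have off: "P $ i $ j = 0" if ij: "r i \<noteq> c j" for i j
  proof -
    define \<epsilon> where "\<epsilon> a = (if a = r i then - 1 else 1 :: real)" for a
    have \<epsilon>: "\<epsilon> a * \<epsilon> a = 1" for a
      by (simp add: \<epsilon>_def)
    define P' :: "real ^ 'n ^ 'm" where "P' = (\<chi> i j. \<epsilon> (r i) * \<epsilon> (c j) * P $ i $ j)"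
    have "energy P' = energy P"
    proof (rule energy_isometry_right)
      let ?f = "\<lambda>z :: real ^ 'n. \<chi> j. \<epsilon> (c j) * z $ j"
      show "orthogonal_transformation ?f"
        by (rule orthogonal_transformation_signs) (rule \<epsilon>)
      fix z
      have "P' *v z = (\<chi> i. \<epsilon> (r i) * (P *v ?f z) $ i)"
        by (simp add: P'_def matrix_vector_mult_def vec_eq_iff sum_distrib_left mult_ac)
      then show "norm (P' *v z) = norm (P *v ?f z)"
        using orthogonal_transformation_norm[OF orthogonal_transformation_signs[of "\<lambda>i. \<epsilon> (r i)"], OF \<epsilon>]
        by simp
    qed
    moreover have "P' \<bullet> D \<sigma> = P \<bullet> D \<sigma>"
      using \<epsilon> by (auto simp: P'_def inner_vec_def rect_diag_def intro!: sum.cong)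
    ultimately have "P' = P"
      by (intro minimizer_unique[OF P]) simp
    then have "\<epsilon> (r i) * \<epsilon> (c j) * P $ i $ j = P $ i $ j"
      by (simp add: P'_def vec_eq_iff)
    then show ?thesis
      using ij by (simp add: \<epsilon>_def)
  qed
  define s where "s a = P $ row_of a $ col_of a" for a
  have PD: "P = D s"
  proof -
    have "P $ i $ j = (if r i = c j then s (r i) else 0)" for i j
    proof (cases "r i = c j")
      case True
      then have "s (r i) = P $ i $ j"
        unfolding s_def row_of_r by simp
      with True show ?thesis
        by simp
    qed (use off in simp)
    then show ?thesis
      by (simp add: vec_eq_iff rect_diag_def)
  qed
  show thesis
  proof
    show "0 \<le> \<bar>s a\<bar>" for a
      by simp
    have "D s \<bullet> D \<sigma> \<le> D (\<lambda>a. \<bar>s a\<bar>) \<bullet> D \<sigma>"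
      unfolding inner_D using \<sigma> by (intro sum_mono mult_right_mono) auto
    then show "energy (D (\<lambda>a. \<bar>s a\<bar>)) - D (\<lambda>a. \<bar>s a\<bar>) \<bullet> D \<sigma> \<le> energy Q - Q \<bullet> D \<sigma>" for Q
      using P[of Q] by (simp add: energy_D_abs PD)
  qed
qed

text \<open>
  The energy and the linear term of the competitor are compared separately; the two hypotheses
  together make it as good as the minimiser, so uniqueness applies.
\<close>

lemma diagonal_minimizer_rigid:
  assumes min: "\<And>Q. energy (D s) - D s \<bullet> D \<sigma> \<le> energy Q - Q \<bullet> D \<sigma>"
    and ij: "i \<in> {1..k}" "j \<in> {1..k}" "i \<noteq> j"
    and same: "\<And>a. a \<noteq> i \<Longrightarrow> a \<noteq> j \<Longrightarrow> t a = s a"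
    and energy: "energy (D t) \<le> energy (D s)"
    and gain: "s i * \<sigma> i + s j * \<sigma> j \<le> t i * \<sigma> i + t j * \<sigma> j"
  shows "t i = s i" "t j = s j"
proof -
  have "D t \<bullet> D \<sigma> - D s \<bullet> D \<sigma> = (\<Sum>a\<in>{1..k}. (t a - s a) * \<sigma> a)"
    by (simp add: inner_D sum_subtractf left_diff_distrib)
  also have "\<dots> = (\<Sum>a\<in>{i, j}. (t a - s a) * \<sigma> a)"
    using ij same by (intro sum.mono_neutral_right) auto
  also have "\<dots> \<ge> 0"
    using ij gain by (simp add: algebra_simps)
  finally have "D t = D s"
    using energy by (intro minimizer_unique[OF min]) simp
  then show "t i = s i" "t j = s j"
    using D_entry[of i t] D_entry[of i s] D_entry[of j t] D_entry[of j s] ij by simp_all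
qed

context
  fixes s \<sigma> :: "nat \<Rightarrow> real"
  assumes s_nonneg: "\<And>a. a \<in> {1..k} \<Longrightarrow> 0 \<le> s a"
    and \<sigma>_nonneg: "\<And>a. a \<in> {1..k} \<Longrightarrow> 0 \<le> \<sigma> a"
    and min: "\<And>Q. energy (D s) - D s \<bullet> D \<sigma> \<le> energy Q - Q \<bullet> D \<sigma>"
begin

lemma minimizer_order:
  assumes ij: "i \<in> {1..k}" "j \<in> {1..k}" and "\<sigma> j \<le> \<sigma> i"
  shows "s j \<le> s i"
proof (rule ccontr)
  assume "\<not> s j \<le> s i"
  then have less: "s i < s j"
    by simp
  then have neq: "i \<noteq> j"
    by auto
  let ?t = "s \<circ> Transposition.transpose i j"
  have "0 \<le> (\<sigma> i - \<sigma> j) * (s j - s i)"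
    using assms(3) less by simp
  then have "s i * \<sigma> i + s j * \<sigma> j \<le> ?t i * \<sigma> i + ?t j * \<sigma> j"
    by (simp add: algebra_simps)
  then have "?t i = s i"
    using energy_D_swap[OF ij, of s]
    by (intro diagonal_minimizer_rigid[OF min ij neq, of ?t]) auto
  with less show False
    by simp
qed

lemma minimizer_cross:
  assumes ij: "i \<in> {1..k}" "j \<in> {1..k}" and \<sigma>: "0 < \<sigma> j" "\<sigma> j \<le> \<sigma> i"
  shows "s i * \<sigma> j \<le> s j * \<sigma> i"
proof (rule ccontr)
  assume "\<not> ?thesis"
  then have less: "s j * \<sigma> i < s i * \<sigma> j"
    by simp
  then have neq: "i \<noteq> j"
    by auto
  obtain u v t where t: "0 \<le> t" "t \<le> 1"
    and u: "u\<^sup>2 = (1 - t) * (s i)\<^sup>2 + t * (s j)\<^sup>2" and v: "v\<^sup>2 = (1 - t) * (s j)\<^sup>2 + t * (s i)\<^sup>2"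
    and gain: "s i * \<sigma> i + s j * \<sigma> j \<le> u * \<sigma> i + v * \<sigma> j" and parallel: "u * \<sigma> j = v * \<sigma> i"
    using rotated_pair[OF s_nonneg[OF ij(2)] \<sigma> less] by blast
  let ?w = "s(i := u, j := v)"
  have "energy (D ?w) \<le> energy (D s)"
    using neq u v by (intro energy_D_mix[OF ij t]) (auto simp: Transposition.transpose_def algebra_simps)
  then have "?w i = s i" "?w j = s j"
    using diagonal_minimizer_rigid[OF min ij neq, of ?w] gain neq by auto
  with parallel less neq show False
    by simp
qed

lemma minimizer_ratio:
  assumes "i \<in> {1..k}" "j \<in> {1..k}"
  shows "ext_ratio (max (s i) (s j)) (min (s i) (s j)) \<le> ext_ratio (max (\<sigma> i) (\<sigma> j)) (min (\<sigma> i) (\<sigma> j))"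
proof -
  have ratio: "ext_ratio (max (s i) (s j)) (min (s i) (s j)) \<le> ext_ratio (max (\<sigma> i) (\<sigma> j)) (min (\<sigma> i) (\<sigma> j))"
    if ij: "i \<in> {1..k}" "j \<in> {1..k}" and le: "\<sigma> j \<le> \<sigma> i" for i j
  proof -
    have "s j \<le> s i"
      using ij le by (rule minimizer_order)
    then have "ext_ratio (s i) (s j) \<le> ext_ratio (\<sigma> i) (\<sigma> j)"
      using ij le minimizer_order[OF ij(2,1)] minimizer_cross[OF ij]
      by (intro ext_ratio_mono s_nonneg \<sigma>_nonneg) auto
    with le \<open>s j \<le> s i\<close> show ?thesis
      by (simp add: max_absorb1 min_absorb2)
  qed
  show ?thesis
  proof (cases "\<sigma> j \<le> \<sigma> i")
    case True
    with assms show ?thesis by (rule ratio)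
  next
    case False
    with ratio[OF assms(2,1)] show ?thesis
      by (simp add: max.commute min.commute)
  qed
qed

end

end

section \<open>Spectrum of the minimiser\<close>

theorem mainTheorem1:
  fixes G :: "real ^ 'n ^ 'm"
    and H :: "real \<Rightarrow> real"
    and M :: "'s measure"
    and \<zeta> :: "'s \<Rightarrow> real ^ 'n"
    and r :: "'m \<Rightarrow> nat"
    and c :: "'n \<Rightarrow> nat"
    and k :: nat
  assumes rows: "bij_betw r UNIV {1..CARD('m)}"
    and cols: "bij_betw c UNIV {1..CARD('n)}"
    and k: "k = min CARD('m) CARD('n)"
    and M: "prob_space M"
    and \<zeta>: "\<zeta> \<in> borel_measurable M"
    and \<zeta>_uniform: "distr M borel \<zeta> = uniform_sphere"
    and H_mono: "strict_mono_on {0..} H"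
    and H_convex: "convex_on {0..} (\<lambda>x. H (sqrt x))"
  shows "\<exists>(Qs :: real ^ 'n ^ 'm) (U :: real ^ 'm ^ 'm) (V :: real ^ 'n ^ 'n)
            (\<sigma> :: nat \<Rightarrow> real) (\<sigma>s :: nat \<Rightarrow> real).
           (\<forall>Q. curvature_objective M \<zeta> G H Qs \<le> curvature_objective M \<zeta> G H Q) \<and>
           orthogonal_matrix U \<and> orthogonal_matrix V \<and>
           (\<forall>i\<in>{1..k}. 0 \<le> \<sigma> i) \<and> (\<forall>i\<in>{1..k}. 0 \<le> \<sigma>s i) \<and>
           G = U ** rect_diag r c \<sigma> ** transpose V \<and>
           Qs = U ** rect_diag r c \<sigma>s ** transpose V \<and>
           (\<forall>i\<in>{1..k}. \<forall>j\<in>{1..k}. \<sigma> j \<le> \<sigma> i \<longrightarrow> \<sigma>s j \<le> \<sigma>s i) \<and>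
           (\<forall>i\<in>{1..k}. \<forall>j\<in>{1..k}.
              ext_ratio (max (\<sigma>s i) (\<sigma>s j)) (min (\<sigma>s i) (\<sigma>s j))
                \<le> ext_ratio (max (\<sigma> i) (\<sigma> j)) (min (\<sigma> i) (\<sigma> j)))"
proof -
  interpret diagonal_curvature H r c k
    using H_mono H_convex rows cols k by unfold_locales
  obtain U V \<sigma> where U: "orthogonal_matrix U" and V: "orthogonal_matrix V"
    and \<sigma>: "\<And>i. i \<in> {1..k} \<Longrightarrow> 0 \<le> \<sigma> i" and G: "G = U ** D \<sigma> ** transpose V"
    using singular_value_decomposition[OF rows cols, of G] unfolding k by metis
  obtain s where s: "\<And>a. a \<in> {1..k} \<Longrightarrow> 0 \<le> s a"
    and min: "\<And>Q. energy (D s) - D s \<bullet> D \<sigma> \<le> energy Q - Q \<bullet> D \<sigma>"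
    using diagonal_minimizer_exists[of \<sigma>] \<sigma> by blast
  have obj: "curvature_objective M \<zeta> G H Q =
      energy (transpose U ** Q ** V) - (transpose U ** Q ** V) \<bullet> D \<sigma>" for Q :: "real ^ 'n ^ 'm"
  proof -
    have "energy (transpose U ** Q ** V) = energy Q"
      using U V by (intro energy_orthogonal) (auto simp: orthogonal_matrix_transpose)
    moreover have "Q \<bullet> G = (transpose U ** Q ** V) \<bullet> D \<sigma>"
    proof -
      have "(transpose U ** Q ** V) \<bullet> D \<sigma> = (transpose U ** Q) \<bullet> (D \<sigma> ** transpose V)"
        by (rule inner_matrix_mult_right)
      also have "\<dots> = Q \<bullet> (U ** (D \<sigma> ** transpose V))"
        by (simp only: inner_matrix_mult_left transpose_transpose)
      finally show ?thesis
        by (simp add: G matrix_mul_assoc)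
    qed
    ultimately show ?thesis
      by (simp add: curvature_objective_eq[OF \<zeta> \<zeta>_uniform])
  qed
  have "transpose U ** (U ** D s ** transpose V) ** V = (transpose U ** U) ** D s ** (transpose V ** V)"
    by (simp only: matrix_mul_assoc)
  also have "\<dots> = D s"
    using U V by (simp add: orthogonal_matrix_def)
  finally have opt: "curvature_objective M \<zeta> G H (U ** D s ** transpose V) \<le> curvature_objective M \<zeta> G H Q" for Q
    using min by (simp add: obj)
  show ?thesis
    using opt U V \<sigma> s G minimizer_order[OF s \<sigma> min] minimizer_ratio[OF s \<sigma> min]
    by (intro exI[of _ "U ** D s ** transpose V"] exI[of _ U] exI[of _ V] exI[of _ \<sigma>] exI[of _ s]) blast
qed

end
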